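(* Let $0<p<1$ and let $P=pP_1+(1-p)P_2$, where $P_1$ and $P_2$ are the uniform distributions on $[0,1]$ and $[1,2]$. Let $n\ge 3$, and let $\alpha_n$ be an optimal set of $n$-means for $P$ containing elements from both $[0,1]$ and $(1,2]$, with $\alpha_n\cap[0,1]=\{a_1<\cdots<a_k\}$ and $\alpha_n\cap(1,2]=\{b_1<b_2<\cdots<b_m\}$, $k+m=n$. Suppose $k=1$ and $m\geq 2$. If $\frac12(a_1+b_1)\leq 1$, then $a_1=E(X : X\in[0,\frac12(a_1+b_1)])$, $b_1=E(X : X\in[\frac12(a_1+b_1),\frac12(b_1+b_2)])$, and \[b_{1+j}=\tfrac12(b_1+b_2)+\frac{2j-1}{2(m-1)}\Big(2-\tfrac12(b_1+b_2)\Big)\quad\text{for }1\leq j\leq m-1,\] and the $n$th quantization error is \[V1(1,m)=p\int_0^{\frac12(a_1+b_1)}(x-a_1)^2\,dx+p\int_{\frac12(a_1+b_1)}^1(x-b_1)^2\,dx+(1-p)\int_1^{\frac12(b_1+b_2)}(x-b_1)^2\,dx+(1-p)\frac{(4-(b_1+b_2))^3}{96(m-1)^2}.\] If $1\leq\frac12(a_1+b_1)$, then $a_1=E(X : X\in[0,\frac12(a_1+b_1)])$, and \[b_j=\tfrac12(a_1+b_1)+\frac{2j-1}{2m}\Big(2-\tfrac12(a_1+b_1)\Big)\quad\text{for }1\leq j\leq m,\] and the $n$th quantization error is \[V2(1,m)=p\int_0^1(x-a_1)^2\,dx+(1-p)\int_1^{\frac12(a_1+b_1)}(x-a_1)^2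\,dx+(1-p)\frac{(4-(a_1+b_1))^3}{96m^2}.\]
   Context: For a Borel probability measure $P$ on $\mathbb{R}$ and $n\in\mathbb{N}$, the $n$th quantization error is $V_n(P)=\inf\{\int\min_{a\in\alpha}(x-a)^2\,dP(x) : \alpha\subset\mathbb{R},\ 1\le\mathrm{card}(\alpha)\le n\}$, and an optimal set of $n$-means for $P$ is a set $\alpha$ with $1\le\mathrm{card}(\alpha)\le n$ attaining this infimum (here it has exactly $n$ elements). $X$ is a random variable with distribution $P$, and $E(X:X\in[u,v])=\frac{1}{P([u,v])}\int_{[u,v]}x\,dP(x)$ is its conditional expectation given $X\in[u,v]$. $V1(k,m)$ denotes the $n$th quantization error when $\frac12(a_k+b_1)\le1$, and $V2(k,m)$ the $n$th quantization error when $1\le\frac12(a_k+b_1)$. *)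

theory Defs
  imports "HOL-Probability.Probability"
begin

text \<open>The mixture \<open>p M + (1 - p) N\<close> of two measures on the same measurable space.\<close>

definition mixture :: "real \<Rightarrow> 'a measure \<Rightarrow> 'a measure \<Rightarrow> 'a measure" where
  "mixture p M N = measure_of (space M) (sets M)
     (\<lambda>A. ennreal p * emeasure M A + ennreal (1 - p) * emeasure N A)"

lemma space_mixture [simp]: "space (mixture p M N) = space M"
  and sets_mixture [simp, measurable_cong]: "sets (mixture p M N) = sets M"
  by (simp_all add: mixture_def)

lemma emeasure_mixture:
  assumes "sets N = sets M" "A \<in> sets M"
  shows "emeasure (mixture p M N) A = ennreal p * emeasure M A + ennreal (1 - p) * emeasure N A"
proof (rule emeasure_measure_of[OF mixture_def])
  show "countably_additive (sets (mixture p M N))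
          (\<lambda>A. ennreal p * emeasure M A + ennreal (1 - p) * emeasure N A)"
  proof (rule countably_additiveI)
    fix F :: "nat \<Rightarrow> 'a set"
    assume F: "range F \<subseteq> sets (mixture p M N)" "disjoint_family F"
    have "(\<Sum>i. emeasure M (F i)) = emeasure M (\<Union>i. F i)"
         "(\<Sum>i. emeasure N (F i)) = emeasure N (\<Union>i. F i)"
      using F assms(1) by (auto intro!: suminf_emeasure)
    then show "(\<Sum>i. ennreal p * emeasure M (F i) + ennreal (1 - p) * emeasure N (F i)) =
        ennreal p * emeasure M (\<Union> (range F)) + ennreal (1 - p) * emeasure N (\<Union> (range F))"
      by (simp add: suminf_add[symmetric] ennreal_suminf_cmult)
  qed
qed (use assms sets.space_closed in \<open>auto simp: positive_def\<close>)

definition mixed_uniform :: "real \<Rightarrow> real measure" where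
  "mixed_uniform p = mixture p (uniform_measure lborel {0..1}) (uniform_measure lborel {1..2})"

lemma prob_space_mixed_uniform:
  assumes "0 < p" "p < 1"
  shows "prob_space (mixed_uniform p)"
proof
  show "emeasure (mixed_uniform p) (space (mixed_uniform p)) = 1"
    using assms
    by (simp add: mixed_uniform_def emeasure_mixture ennreal_plus[symmetric] del: ennreal_plus)
qed

text \<open>The integral is taken in \<^typ>\<open>ennreal\<close>, so that the error of a measure without second moment
  is \<open>\<infinity>\<close> rather than the junk value \<open>0\<close> of the Bochner integral.\<close>

definition distortion :: "real measure \<Rightarrow> real set \<Rightarrow> ennreal" where
  "distortion P \<alpha> = (\<integral>\<^sup>+x. ennreal (MIN a\<in>\<alpha>. (x - a)\<^sup>2) \<partial>P)"

text \<open>Since infinite sets have \<^const>\<open>card\<close> zero, \<open>1 \<le> card \<alpha>\<close> below makes \<open>\<alpha>\<close> finite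
  and nonempty.\<close>

definition quantization_error :: "nat \<Rightarrow> real measure \<Rightarrow> ennreal" where
  "quantization_error n P = (INF \<alpha>\<in>{\<alpha>. 1 \<le> card \<alpha> \<and> card \<alpha> \<le> n}. distortion P \<alpha>)"

definition optimal_n_means :: "nat \<Rightarrow> real measure \<Rightarrow> real set \<Rightarrow> bool" where
  "optimal_n_means n P \<alpha> \<longleftrightarrow>
     1 \<le> card \<alpha> \<and> card \<alpha> \<le> n \<and> distortion P \<alpha> = quantization_error n P"

text \<open>\<open>E(X : X \<in> [u,v])\<close> for a random variable \<open>X\<close> with distribution \<open>P\<close>.\<close>

definition cond_mean :: "real measure \<Rightarrow> real \<Rightarrow> real \<Rightarrow> real" where
  "cond_mean P u v = (LINT x:{u..v}|P. x) / measure P {u..v}"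

end

theory Submission
  imports Defs
begin

text \<open>
  The idea is a centroid condition. If a point of an optimal set is moved to the conditional
  expectation of its Voronoi cell, the mean squared distance over that cell drops by the
  probability of the cell times the squared displacement (the variance identity), and the
  nearest-point rule can only lower the distortion further. Optimality therefore
  forces each point whose cell has positive probability to be the conditional expectation of its
  cell (\<open>optimal_point_is_centroid\<close>).

  The hypotheses exhibit \<open>n\<close> distinct elements of the optimal set, so it contains nothing
  else, and one may write it as an increasing sequence \<open>c 0 < \<dots> < c m\<close> in \<open>[0,2]\<close>, where
  \<open>c 0 = a 1\<close> and \<open>c i = b i\<close> for \<open>i > 0\<close>. Its Voronoi cells in \<open>[0,2]\<close> are the intervals
  between consecutive midpoints, closed off by the end points \<open>0\<close> and \<open>2\<close>.

  Suppose that the left end \<open>t\<close> of the cell of \<open>c (r + 1)\<close> is at least \<open>1\<close>. On \<open>[t,2]\<close> the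
  distribution is a multiple of Lebesgue measure, so each of \<open>c (r + 1), \<dots>, c m\<close> is the midpoint
  of its cell. As each inner cell boundary is also the midpoint of two neighbouring points, all
  the half-widths agree; they equal \<open>d = (2 - t) / (2 (m - r))\<close>, and the \<open>m - r\<close> cells
  contribute \<open>2/3 d\<^sup>3\<close> each to the integral of the squared distance, in total
  \<open>(2 - t)\<^sup>3 / (12 (m - r)\<^sup>2)\<close> (\<open>equally_spaced\<close>, \<open>min_sq_dist_has_integral_tail\<close>).

  The two parts of the theorem are \<open>r = 1\<close>, where the cell of \<open>b 1\<close> may straddle the jump of the
  density at \<open>1\<close> while the next boundary exceeds \<open>1\<close> because \<open>b 1\<close> and \<open>b 2\<close> do, and \<open>r = 0\<close>,
  where already the first boundary is at least \<open>1\<close>.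
\<close>

section \<open>The centroid condition\<close>

text \<open>Let \<open>c'\<close> be the conditional expectation given \<open>S\<close>. Replacing \<open>c\<close> by \<open>c'\<close> and serving
  \<open>S\<close> from \<open>c'\<close>, and everything else from a nearest remaining point, lowers the distortion by at least
  \<open>measure P S * (c' - c)\<^sup>2\<close>. The hypotheses on \<open>S\<close> fix it as the Voronoi cell of \<open>c\<close> only up to ties
  and null sets, so that the cell may be cut down to the support of \<open>P\<close>.\<close>

lemma optimal_point_is_centroid:
  fixes P :: "real measure"
  assumes P: "finite_measure P" and sets_P [measurable_cong]: "sets P = sets borel"
    and sq: "integrable P (\<lambda>x. x\<^sup>2)"
    and opt: "optimal_n_means n P \<alpha>" and c: "c \<in> \<alpha>"
    and S [measurable]: "S \<in> sets borel" and pos: "measure P S > 0"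
    and cell: "AE x in P. x \<in> S \<longrightarrow> (\<forall>a\<in>\<alpha>. (x - c)\<^sup>2 \<le> (x - a)\<^sup>2)"
    and off: "AE x in P. x \<notin> S \<longrightarrow> (\<exists>a\<in>\<alpha> - {c}. (x - a)\<^sup>2 \<le> (x - c)\<^sup>2)"
  shows "c = (LINT x:S|P. x) / measure P S"
proof -
  interpret finite_measure P by fact
  define c' where "c' = (LINT x:S|P. x) / measure P S"
  define \<beta> where "\<beta> = insert c' (\<alpha> - {c})"
  define f where "f \<gamma> x = (MIN a\<in>\<gamma>. (x - a)\<^sup>2)" for \<gamma> :: "real set" and x
  have card_\<alpha>: "1 \<le> card \<alpha>" "card \<alpha> \<le> n"
    using opt by (auto simp: optimal_n_means_def)
  then have fin: "finite \<alpha>" using card.infinite by fastforce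
  then have fin': "finite \<beta>" "\<beta> \<noteq> {}" "c' \<in> \<beta>" by (auto simp: \<beta>_def)
  have "card \<beta> \<le> Suc (card (\<alpha> - {c}))"
    unfolding \<beta>_def by (simp add: fin card_insert_if)
  then have card_\<beta>: "card \<beta> \<le> n" using c fin card_\<alpha> by (simp add: card_Diff_singleton)
  have "1 \<le> card \<beta>" using fin' by (simp add: Suc_le_eq card_gt_0_iff)
  then have le: "distortion P \<alpha> \<le> distortion P \<beta>"
    using opt card_\<beta> by (auto simp: optimal_n_means_def quantization_error_def intro!: INF_lower)
  have lin [simp]: "integrable P (\<lambda>x. x)"
    by (rule square_integrable_imp_integrable) (use sq in auto)
  have shifted: "integrable P (\<lambda>x. (x - a)\<^sup>2)" for a
    using sq by (simp add: power2_diff)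
  have f_nonneg: "0 \<le> f \<gamma> x" if "finite \<gamma>" "\<gamma> \<noteq> {}" for \<gamma> x
    using that by (auto simp: f_def)
  have f_le: "f \<gamma> x \<le> (x - a)\<^sup>2" if "finite \<gamma>" "a \<in> \<gamma>" for \<gamma> x a
    using that by (auto simp: f_def)
  have f_meas [measurable]: "f \<gamma> \<in> borel_measurable borel" if "finite \<gamma>" for \<gamma>
    unfolding f_def using that by measurable
  have f_int: "integrable P (f \<gamma>)" if "finite \<gamma>" "a \<in> \<gamma>" for \<gamma> a
  proof (rule Bochner_Integration.integrable_bound[OF shifted[of a]])
    show "f \<gamma> \<in> borel_measurable P" using f_meas[OF that(1)] by measurable
    have "\<gamma> \<noteq> {}" using that by auto
    then have "norm (f \<gamma> x) \<le> norm ((x - a)\<^sup>2)" for x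
      using f_le[OF that, of x] f_nonneg[OF that(1), of x] by simp
    then show "AE x in P. norm (f \<gamma> x) \<le> norm ((x - a)\<^sup>2)" by simp
  qed
  have dist: "distortion P \<gamma> = ennreal (LINT x|P. f \<gamma> x)" if "finite \<gamma>" "a \<in> \<gamma>" for \<gamma> a
    unfolding distortion_def f_def[symmetric]
    by (rule nn_integral_eq_integral[OF f_int[OF that]]) (use that f_nonneg in auto)
  have f_le': "(LINT x|P. f \<alpha> x) \<le> (LINT x|P. f \<beta> x)"
    using le dist[OF fin c] dist[OF fin'(1,3)] f_nonneg[OF fin'(1,2)]
    by (simp add: ennreal_le_iff integral_nonneg_AE)
  have intS: "integrable P (\<lambda>x. indicator S x * x)"
    using integrable_mult_indicator[OF _ lin, of S] sets_P by simp
  \<comment> \<open>On \<open>S\<close> the correction term is \<open>(x - c')\<^sup>2 - (x - c)\<^sup>2\<close>; its integral is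
    \<open>- (c' - c)\<^sup>2\<close> times the measure of \<open>S\<close>.\<close>
  have "AE x in P. f \<beta> x \<le> f \<alpha> x + (c' - c) * (c' + c) * indicator S x - 2 * (c' - c) * (indicator S x * x)"
    using cell off
  proof eventually_elim
    case (elim x)
    show ?case
    proof (cases "x \<in> S")
      case True
      have "f \<alpha> x = (x - c)\<^sup>2"
        unfolding f_def by (rule Min_eqI) (use fin c elim True in auto)
      moreover have "f \<beta> x \<le> (x - c')\<^sup>2" by (rule f_le[OF fin'(1,3)])
      moreover have "(x - c')\<^sup>2 = (x - c)\<^sup>2 + (c' - c) * (c' + c) - 2 * (c' - c) * x"
        by (simp add: power2_eq_square algebra_simps)
      ultimately show ?thesis using True by simp
    next
      case False
      have "f \<alpha> x \<in> (\<lambda>a. (x - a)\<^sup>2) ` \<alpha>"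
        unfolding f_def using fin c by (intro Min_in) auto
      then obtain e where e: "e \<in> \<alpha>" "f \<alpha> x = (x - e)\<^sup>2" by auto
      \<comment> \<open>If the minimum was attained at the removed point \<open>c\<close>, another point of \<open>\<alpha>\<close> does as well.\<close>
      obtain d where d: "d \<in> \<beta>" "(x - d)\<^sup>2 \<le> (x - e)\<^sup>2"
        using False e elim by (cases "e = c") (auto simp: \<beta>_def)
      show ?thesis using f_le[OF fin'(1) d(1), of x] d e False by simp
    qed
  qed
  then have "(LINT x|P. f \<beta> x) \<le>
      (LINT x|P. f \<alpha> x + (c' - c) * (c' + c) * indicator S x - 2 * (c' - c) * (indicator S x * x))"
    using f_int[OF fin'(1,3)] f_int[OF fin c] intS
    by (intro integral_mono_AE) (auto simp: sets_P emeasure_finite less_top[symmetric])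
  also have "\<dots> = (LINT x|P. f \<alpha> x) + (c' - c) * (c' + c) * measure P S - 2 * (c' - c) * (LINT x:S|P. x)"
    using f_int[OF fin c] intS
    by (simp add: sets_P emeasure_finite less_top[symmetric] set_lebesgue_integral_def)
  also have "(LINT x:S|P. x) = c' * measure P S"
    using pos by (simp add: c'_def)
  finally have "(c' - c)\<^sup>2 * measure P S \<le> 0"
    using f_le' by (simp add: power2_eq_square algebra_simps)
  then have "(c' - c)\<^sup>2 \<le> 0" using pos by (simp add: mult_le_0_iff)
  then show ?thesis by (simp add: c'_def)
qed

section \<open>The mixture of the two uniform distributions\<close>

lemma sets_mixed_uniform [simp, measurable_cong]: "sets (mixed_uniform p) = sets borel"
  by (simp add: mixed_uniform_def)

text \<open>At the shared end point \<open>1\<close> this density takes the value \<open>p + (1 - p)\<close>. The two closed intervals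
  may overlap there because a single point is a Lebesgue null set.\<close>

lemma mixed_uniform_eq_density:
  assumes p: "0 < p" "p < 1"
  shows "mixed_uniform p = density lborel
    (\<lambda>x. ennreal (p * indicator {0..1} x + (1 - p) * indicator {1..2} x))"
proof (rule measure_eqI)
  fix A assume "A \<in> sets (mixed_uniform p)"
  then have A [measurable]: "A \<in> sets borel" by simp
  have "emeasure (density lborel
      (\<lambda>x. ennreal (p * indicator {0..1} x + (1 - p) * indicator {1..2} x))) A =
    (\<integral>\<^sup>+x. ennreal p * indicator ({0..1} \<inter> A) x + ennreal (1 - p) * indicator ({1..2} \<inter> A) x \<partial>lborel)"
    using p by (subst emeasure_density)
      (auto intro!: nn_integral_cong simp: indicator_def ennreal_plus[symmetric] simp del: ennreal_plus)
  also have "\<dots> = emeasure (mixed_uniform p) A"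
    by (simp add: mixed_uniform_def emeasure_mixture nn_integral_add nn_integral_cmult_indicator divide_ennreal_def)
  finally show "emeasure (mixed_uniform p) A = emeasure (density lborel
      (\<lambda>x. ennreal (p * indicator {0..1} x + (1 - p) * indicator {1..2} x))) A" by simp
qed simp

lemma AE_mixed_uniform_Icc:
  assumes p: "0 < p" "p < 1"
  shows "AE x in mixed_uniform p. x \<in> {0..2}"
  unfolding mixed_uniform_eq_density[OF p]
  by (subst AE_density) (auto simp: indicator_def split: if_splits)

text \<open>Since both weights are positive, it suffices that the interval overlaps one of \<open>[0,1]\<close> and
  \<open>[1,2]\<close> in an interval of positive length.\<close>

lemma measure_mixed_uniform_Icc_pos:
  assumes p: "0 < p" "p < 1" and "0 \<le> u" "u < v" "v \<le> 2"
  shows "measure (mixed_uniform p) {u..v} > 0"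
proof -
  interpret prob_space "mixed_uniform p" by (rule prob_space_mixed_uniform[OF p])
  have "emeasure (mixed_uniform p) {u..v} \<noteq> 0"
  proof (cases "u < 1")
    case True
    then have "{0..1} \<inter> {u..v} = {u..min 1 v}" using assms by auto
    then show ?thesis using assms True
      by (simp add: mixed_uniform_def emeasure_mixture divide_ennreal_def)
  next
    case False
    then have "{1..2} \<inter> {u..v} = {u..v}" using assms by auto
    then show ?thesis using assms False
      by (simp add: mixed_uniform_def emeasure_mixture divide_ennreal_def)
  qed
  then show ?thesis by (simp add: emeasure_eq_measure zero_less_measure_iff)
qed

lemma cond_mean_mixed_uniform_right:
  assumes p: "0 < p" "p < 1" and "1 \<le> u" "u < v" "v \<le> 2"
  shows "cond_mean (mixed_uniform p) u v = (u + v) / 2"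
proof -
  let ?h = "\<lambda>x::real. p * indicator {0..1} x + (1 - p) * indicator {1..2} x"
  have h: "(LINT x:{u..v}|mixed_uniform p. g x) = (1 - p) * (LINT x:{u..v}|lborel. g x)"
    if [measurable]: "g \<in> borel_measurable borel" for g :: "real \<Rightarrow> real"
  proof -
    have "(LINT x:{u..v}|mixed_uniform p. g x) = (LINT x|lborel. ?h x *\<^sub>R (indicator {u..v} x *\<^sub>R g x))"
      unfolding mixed_uniform_eq_density[OF p] set_lebesgue_integral_def
      using p by (subst integral_density) auto
    also have "\<dots> = (LINT x|lborel. (1 - p) * (indicator {u..v} x *\<^sub>R g x))"
      by (rule integral_cong_AE)
        (use AE_lborel_singleton[of 1] assms in \<open>auto simp: indicator_def elim!: eventually_mono\<close>)
    finally show ?thesis by (simp add: set_lebesgue_integral_def)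
  qed
  have "(LINT x:{u..v}|lborel. x) = integral {u..v} (\<lambda>x. x)"
    by (rule set_borel_integral_eq_integral, rule borel_integrable_atLeastAtMost') (intro continuous_intros)
  also have "\<dots> = (v\<^sup>2 - u\<^sup>2) / 2"
    using assms ident_has_integral[of u v] by (simp add: integral_unique)
  finally have m: "(LINT x:{u..v}|mixed_uniform p. x) = (1 - p) * ((v\<^sup>2 - u\<^sup>2) / 2)"
    by (simp add: h)
  interpret prob_space "mixed_uniform p" by (rule prob_space_mixed_uniform[OF p])
  have "(LINT x:{u..v}|mixed_uniform p. 1) = (1 - p) * (LINT x:{u..v}|lborel. 1)"
    by (rule h) simp
  then have meas: "measure (mixed_uniform p) {u..v} = (1 - p) * (v - u)"
    using assms by (simp add: set_lebesgue_integral_def)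
  have "(1 - p) * ((v\<^sup>2 - u\<^sup>2) / 2) = ((1 - p) * (v - u)) * ((u + v) / 2)"
    by (simp add: power2_eq_square field_simps)
  moreover have "(1 - p) * (v - u) \<noteq> 0" using assms by simp
  ultimately show ?thesis
    unfolding cond_mean_def m meas by (metis nonzero_mult_div_cancel_left)
qed

lemma distortion_mixed_uniform:
  assumes p: "0 < p" "p < 1" and "finite \<alpha>" "\<alpha> \<noteq> {}"
    and A: "((\<lambda>x. MIN a\<in>\<alpha>. (x - a)\<^sup>2) has_integral A) {0..1}"
    and B: "((\<lambda>x. MIN a\<in>\<alpha>. (x - a)\<^sup>2) has_integral B) {1..2}"
  shows "distortion (mixed_uniform p) \<alpha> = ennreal (p * A + (1 - p) * B)"
proof -
  define f where "f x = (MIN a\<in>\<alpha>. (x - a)\<^sup>2)" for x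
  have nonneg: "0 \<le> f x" for x using assms by (auto simp: f_def)
  have [measurable]: "f \<in> borel_measurable borel" unfolding f_def using assms(3) by measurable
  have AB: "(\<integral>\<^sup>+x. ennreal (indicator {0..1} x * f x) \<partial>lborel) = ennreal A"
       "(\<integral>\<^sup>+x. ennreal (indicator {1..2} x * f x) \<partial>lborel) = ennreal B"
    by (rule nn_integral_has_integral_lebesgue; use A B nonneg in \<open>simp add: f_def\<close>)+
  have AB_nonneg: "0 \<le> A" "0 \<le> B"
    by (rule has_integral_nonneg[OF A] has_integral_nonneg[OF B], use nonneg in \<open>simp add: f_def\<close>)+
  have "distortion (mixed_uniform p) \<alpha> =
      (\<integral>\<^sup>+x. ennreal p * ennreal (indicator {0..1} x * f x)
         + ennreal (1 - p) * ennreal (indicator {1..2} x * f x) \<partial>lborel)"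
    unfolding distortion_def f_def[symmetric] mixed_uniform_eq_density[OF p]
  proof (subst nn_integral_density)
    have "ennreal (p * indicator {0..1} x + (1 - p) * indicator {1..2} x) * ennreal (f x) =
        ennreal p * ennreal (indicator {0..1} x * f x)
          + ennreal (1 - p) * ennreal (indicator {1..2} x * f x)" for x
    proof -
      have "ennreal (p * indicator {0..1} x + (1 - p) * indicator {1..2} x) * ennreal (f x) =
          ennreal (p * (indicator {0..1} x * f x) + (1 - p) * (indicator {1..2} x * f x))"
        using p nonneg by (subst ennreal_mult[symmetric]) (auto simp: algebra_simps indicator_def)
      also have "\<dots> = ennreal p * ennreal (indicator {0..1} x * f x)
          + ennreal (1 - p) * ennreal (indicator {1..2} x * f x)"
        using p nonneg by (subst ennreal_plus) (simp_all add: ennreal_mult)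
      finally show ?thesis .
    qed
    then show "(\<integral>\<^sup>+x. ennreal (p * indicator {0..1} x + (1 - p) * indicator {1..2} x) * ennreal (f x) \<partial>lborel) =
        (\<integral>\<^sup>+x. ennreal p * ennreal (indicator {0..1} x * f x)
          + ennreal (1 - p) * ennreal (indicator {1..2} x * f x) \<partial>lborel)" by simp
  qed simp_all
  also have "\<dots> = ennreal p * ennreal A + ennreal (1 - p) * ennreal B"
    by (simp add: nn_integral_add nn_integral_cmult AB)
  finally show ?thesis
    using p AB_nonneg by (simp add: ennreal_mult ennreal_plus)
qed

section \<open>Voronoi cells on the line\<close>

text \<open>For an increasing sequence \<open>c 0, \<dots>, c m\<close> in \<open>[0,2]\<close> the Voronoi cell of \<open>c i\<close> within \<open>[0,2]\<close>
  is \<open>{cell_bound m c i..cell_bound m c (Suc i)}\<close>; the outermost bounds are the end points of the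
  support, so that the first and last cells need no separate treatment.\<close>

definition cell_bound :: "nat \<Rightarrow> (nat \<Rightarrow> real) \<Rightarrow> nat \<Rightarrow> real" where
  "cell_bound m c i = (if i = 0 then 0 else if i \<le> m then (c (i - 1) + c i) / 2 else 2)"

lemma sq_dist_le_iff:
  fixes u w x :: real
  assumes "u < w"
  shows "(x - u)\<^sup>2 \<le> (x - w)\<^sup>2 \<longleftrightarrow> x \<le> (u + w) / 2"
    and "(x - w)\<^sup>2 \<le> (x - u)\<^sup>2 \<longleftrightarrow> (u + w) / 2 \<le> x"
proof -
  have eq: "(x - w)\<^sup>2 - (x - u)\<^sup>2 = (w - u) * (u + w - 2 * x)"
    by (simp add: power2_eq_square algebra_simps)
  have "(x - u)\<^sup>2 \<le> (x - w)\<^sup>2 \<longleftrightarrow> 0 \<le> (w - u) * (u + w - 2 * x)" unfolding eq[symmetric] by simp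
  then show "(x - u)\<^sup>2 \<le> (x - w)\<^sup>2 \<longleftrightarrow> x \<le> (u + w) / 2"
    using assms by (auto simp: zero_le_mult_iff)
  have "(x - w)\<^sup>2 \<le> (x - u)\<^sup>2 \<longleftrightarrow> (w - u) * (u + w - 2 * x) \<le> 0" unfolding eq[symmetric] by simp
  then show "(x - w)\<^sup>2 \<le> (x - u)\<^sup>2 \<longleftrightarrow> (u + w) / 2 \<le> x"
    using assms by (auto simp: mult_le_0_iff)
qed

lemma nearest_in_cell:
  assumes c: "strict_mono_on {0..m} c" and "i \<le> m" "j \<le> m"
    and x: "x \<in> {cell_bound m c i..cell_bound m c (Suc i)}"
  shows "(x - c i)\<^sup>2 \<le> (x - c j)\<^sup>2"
proof -
  note mono = strict_mono_onD[OF c] monotone_onD[OF strict_mono_on_imp_mono_on[OF c]]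
  consider "j = i" | "i < j" | "j < i" by linarith
  then show ?thesis
  proof cases
    case 2
    then have "c i < c j" "c (Suc i) \<le> c j" using assms by (auto intro!: mono)
    then show ?thesis using x 2 assms by (auto simp: cell_bound_def sq_dist_le_iff)
  next
    case 3
    then have "c j < c i" "c j \<le> c (i - 1)" using assms by (auto intro!: mono)
    then show ?thesis using x 3 assms by (auto simp: cell_bound_def sq_dist_le_iff)
  qed simp
qed

text \<open>A number left of the cell is nearer to the preceding point, one right of it to the following
  one. The restriction to \<open>[0,2]\<close> guarantees that this neighbour exists.\<close>

lemma neighbour_nearer_off_cell:
  assumes c: "strict_mono_on {0..m} c" and "i \<le> m" and "x \<in> {0..2}"
    and x: "x \<notin> {cell_bound m c i..cell_bound m c (Suc i)}"
  shows "\<exists>a\<in>c ` {0..m} - {c i}. (x - a)\<^sup>2 \<le> (x - c i)\<^sup>2"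
proof (cases "x < cell_bound m c i")
  case True
  then have "0 < i" "x < (c (i - 1) + c i) / 2" using assms by (auto simp: cell_bound_def split: if_splits)
  moreover from this have "c (i - 1) < c i" using assms by (auto intro!: strict_mono_onD[OF c])
  ultimately show ?thesis using assms by (intro bexI[of _ "c (i - 1)"]) (auto simp: sq_dist_le_iff)
next
  case False
  then have "i < m" "x > (c i + c (Suc i)) / 2" using assms by (auto simp: cell_bound_def split: if_splits)
  moreover from this have "c i < c (Suc i)" using assms by (auto intro!: strict_mono_onD[OF c])
  ultimately show ?thesis using assms by (intro bexI[of _ "c (Suc i)"]) (auto simp: sq_dist_le_iff)
qed

lemma cell_bound_less:
  assumes c: "strict_mono_on {0..m} c" and range: "c ` {0..m} \<subseteq> {0..2}" and "0 < m" "i \<le> m"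
  shows "cell_bound m c i < cell_bound m c (Suc i)"
    and "0 \<le> cell_bound m c i" and "cell_bound m c (Suc i) \<le> 2"
proof -
  have r: "0 \<le> c j" "c j \<le> 2" if "j \<le> m" for j using range that by (auto simp: image_subset_iff)
  have lo: "cell_bound m c i \<le> c i" "0 < i \<Longrightarrow> cell_bound m c i < c i"
    using strict_mono_onD[OF c, of "i - 1" i] r[of i] assms by (auto simp: cell_bound_def)
  have hi: "c i \<le> cell_bound m c (Suc i)" "i < m \<Longrightarrow> c i < cell_bound m c (Suc i)"
    using strict_mono_onD[OF c, of i "Suc i"] r[of i] assms by (auto simp: cell_bound_def)
  show "cell_bound m c i < cell_bound m c (Suc i)" 
  proof (cases "i = 0")
    case True
    then show ?thesis using lo(1) hi(2) assms(3) by simp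
  next
    case False
    then show ?thesis using lo(2) hi(1) by simp
  qed
  show "0 \<le> cell_bound m c i" using r[of i] r[of "i - 1"] assms by (auto simp: cell_bound_def)
  show "cell_bound m c (Suc i) \<le> 2" using r[of i] r[of "Suc i"] assms by (auto simp: cell_bound_def)
qed

lemma has_integral_sq_dist:
  fixes u v a :: real
  assumes "u \<le> v"
  shows "((\<lambda>x. (x - a)\<^sup>2) has_integral ((v - a) ^ 3 - (u - a) ^ 3) / 3) {u..v}"
proof -
  have "((\<lambda>x. (x - a)\<^sup>2) has_integral (v - a) ^ 3 / 3 - (u - a) ^ 3 / 3) {u..v}"
    by (rule fundamental_theorem_of_calculus[OF assms])
      (auto intro!: derivative_eq_intros simp: has_real_derivative_iff_has_vector_derivative[symmetric] power2_eq_square)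
  then show ?thesis by (simp add: diff_divide_distrib)
qed

text \<open>Here \<open>[t, t + 2 N d]\<close> is cut into \<open>N\<close> cells of half-width \<open>d\<close>, and \<open>f\<close> is the squared distance
  to the midpoint of the current cell, so each cell contributes the integral of \<open>y\<^sup>2\<close> over
  \<open>[-d, d]\<close>.\<close>

lemma has_integral_equal_cells:
  fixes f :: "real \<Rightarrow> real"
  assumes "0 \<le> d"
    and "\<And>j x. \<lbrakk>j \<in> {1..N}; x \<in> {t + 2 * (real j - 1) * d..t + 2 * real j * d}\<rbrakk>
      \<Longrightarrow> f x = (x - (t + (2 * real j - 1) * d))\<^sup>2"
  shows "(f has_integral N * (2 / 3 * d ^ 3)) {t..t + 2 * real N * d}"
  using assms(2)
proof (induction N)
  case 0
  then show ?case using has_integral_refl(2)[of f t] by simp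
next
  case (Suc N)
  let ?u = "t + 2 * real N * d" and ?v = "t + 2 * real (Suc N) * d"
  let ?a = "t + (2 * real (Suc N) - 1) * d"
  have uv: "?u \<le> ?v" using assms(1) by (simp add: algebra_simps)
  have va: "?v - ?a = d" and ua: "?u - ?a = - d" by (auto simp: algebra_simps)
  have "(d ^ 3 - (- d) ^ 3) / 3 = 2 / 3 * d ^ 3" by simp
  with has_integral_sq_dist[OF uv, of ?a, unfolded va ua]
  have "((\<lambda>x. (x - ?a)\<^sup>2) has_integral 2 / 3 * d ^ 3) {?u..?v}" by (simp only:)
  then have "(f has_integral 2 / 3 * d ^ 3) {?u..?v}"
    by (rule has_integral_eq[rotated]) (use Suc.prems[of "Suc N"] in auto)
  moreover have "(f has_integral N * (2 / 3 * d ^ 3)) {t..?u}"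
    using Suc.prems by (intro Suc.IH) auto
  ultimately have "(f has_integral N * (2 / 3 * d ^ 3) + 2 / 3 * d ^ 3) {t..?v}"
    by (intro has_integral_combine[OF _ uv]) (use assms(1) in auto)
  moreover have "N * (2 / 3 * d ^ 3) + 2 / 3 * d ^ 3 = Suc N * (2 / 3 * d ^ 3)"
    by (simp only: of_nat_Suc distrib_right mult_1 add.commute)
  ultimately show ?case by (simp only:)
qed

text \<open>The first condition makes the two halves of each cell equally long, the second makes the right
  half of a cell as long as the left half of the next one. Hence all half cells have the same length.\<close>

lemma equal_cells_if_midpoints:
  fixes t c :: "nat \<Rightarrow> real"
  assumes "0 < N"
    and mid: "\<And>j. j \<in> {1..N} \<Longrightarrow> c j = (t (j - 1) + t j) / 2"
    and bd: "\<And>j. j \<in> {1..<N} \<Longrightarrow> t j = (c j + c (Suc j)) / 2"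
  defines "d \<equiv> (t N - t 0) / (2 * real N)"
  shows "j \<le> N \<Longrightarrow> t j = t 0 + 2 * real j * d"
    and "j \<in> {1..N} \<Longrightarrow> c j = t 0 + (2 * real j - 1) * d"
proof -
  define e where "e = (t 1 - t 0) / 2"
  have *: "t j = t 0 + 2 * real j * e \<and> (0 < j \<longrightarrow> c j = t 0 + (2 * real j - 1) * e)" if "j \<le> N" for j
    \<comment> \<open>Take the first half-width \<open>e\<close> as step; that \<open>e = d\<close> follows at the end from \<open>j = N\<close>.\<close>
    using that
  proof (induction j)
    case (Suc j)
    show ?case
    proof (cases "j = 0")
      case True
      then show ?thesis using mid[of 1] Suc.prems by (auto simp: e_def field_simps)
    next
      case False
      then have IH: "t j = t 0 + 2 * real j * e" "c j = t 0 + (2 * real j - 1) * e" using Suc by auto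
      have "c (Suc j) = 2 * t j - c j" using bd[of j] False Suc.prems by (simp add: field_simps)
      moreover have "t (Suc j) = 2 * c (Suc j) - t j" using mid[of "Suc j"] Suc.prems by (simp add: field_simps)
      ultimately show ?thesis using IH by (simp add: algebra_simps)
    qed
  qed simp
  have "d = e" using *[of N] assms(1) by (simp add: d_def)
  then show "j \<le> N \<Longrightarrow> t j = t 0 + 2 * real j * d"
    and "j \<in> {1..N} \<Longrightarrow> c j = t 0 + (2 * real j - 1) * d" using *[of j] by simp_all
qed

section \<open>Optimal configurations in increasing order\<close>

locale optimal_configuration =
  fixes p :: real and n m :: nat and c :: "nat \<Rightarrow> real"
  assumes p: "0 < p" "p < 1"
    and opt: "optimal_n_means n (mixed_uniform p) (c ` {0..m})"
    and mono: "strict_mono_on {0..m} c"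
    and range: "c ` {0..m} \<subseteq> {0..2}"
    and m_pos: "0 < m"
begin

abbreviation "s \<equiv> cell_bound m c"

definition min_sq_dist :: "real \<Rightarrow> real" where
  "min_sq_dist x = (MIN a\<in>c ` {0..m}. (x - a)\<^sup>2)"

lemma min_sq_dist_on_cell:
  assumes "i \<le> m" "x \<in> {s i..s (Suc i)}"
  shows "min_sq_dist x = (x - c i)\<^sup>2"
  unfolding min_sq_dist_def
  by (rule Min_eqI) (use assms nearest_in_cell[OF mono] in auto)

lemma min_sq_dist_has_integral_within_cell:
  assumes "i \<le> m" "s i \<le> u" "u \<le> v" "v \<le> s (Suc i)"
  shows "(min_sq_dist has_integral integral {u..v} (\<lambda>x. (x - c i)\<^sup>2)) {u..v}"
proof (rule has_integral_eq[rotated])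
  show "((\<lambda>x. (x - c i)\<^sup>2) has_integral integral {u..v} (\<lambda>x. (x - c i)\<^sup>2)) {u..v}"
    using has_integral_sq_dist[OF assms(3)] by (rule integrable_integral[OF has_integral_integrable])
qed (use assms in \<open>auto simp: min_sq_dist_on_cell\<close>)

lemma point_is_cond_mean:
  assumes i: "i \<le> m"
  shows "c i = cond_mean (mixed_uniform p) (s i) (s (Suc i))"
  unfolding cond_mean_def
proof (rule optimal_point_is_centroid[OF _ _ _ opt])
  interpret prob_space "mixed_uniform p" by (rule prob_space_mixed_uniform[OF p])
  show "finite_measure (mixed_uniform p)" by (rule finite_measure_axioms)
  show "integrable (mixed_uniform p) (\<lambda>x. x\<^sup>2)"
  proof (rule integrable_const_bound[of _ 4])
    show "AE x in mixed_uniform p. norm (x\<^sup>2) \<le> 4"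
      using AE_mixed_uniform_Icc[OF p]
    proof eventually_elim
      case (elim x)
      then show ?case using power_mono[of x 2 2] by simp
    qed
  qed simp
  show "0 < measure (mixed_uniform p) {s i..s (Suc i)}"
    using cell_bound_less[OF mono range m_pos i] by (intro measure_mixed_uniform_Icc_pos p) auto
  show "AE x in mixed_uniform p. x \<in> {s i..s (Suc i)} \<longrightarrow>
      (\<forall>a\<in>c ` {0..m}. (x - c i)\<^sup>2 \<le> (x - a)\<^sup>2)"
    using nearest_in_cell[OF mono i] by auto
  show "AE x in mixed_uniform p. x \<notin> {s i..s (Suc i)} \<longrightarrow>
      (\<exists>a\<in>c ` {0..m} - {c i}. (x - a)\<^sup>2 \<le> (x - c i)\<^sup>2)"
    using AE_mixed_uniform_Icc[OF p]
    by eventually_elim (use neighbour_nearer_off_cell[OF mono i] in blast)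
qed (use i in auto)

lemma cell_bound_mono:
  assumes "i \<le> j" "j \<le> Suc m"
  shows "s i \<le> s j"
  using assms
proof (induction j rule: dec_induct)
  case (step j)
  then show ?case using cell_bound_less(1)[OF mono range m_pos, of j] by auto
qed simp

text \<open>The cells to the right of \<open>s (Suc r)\<close> lie in \<open>[1,2]\<close>, where the conditional mean of an interval
  is its midpoint, so the points there and the cell bounds bisect each other. The position of the
  points and the integral rest on the same step length \<open>d\<close> and are therefore derived together.\<close>

lemma
  assumes r: "r < m" and right: "1 \<le> s (Suc r)"
  shows equally_spaced: "\<And>j. j \<in> {1..m - r} \<Longrightarrow>
      c (r + j) = s (Suc r) + (2 * real j - 1) / (2 * (real m - real r)) * (2 - s (Suc r))"
    and min_sq_dist_has_integral_tail:
      "(min_sq_dist has_integral (2 - s (Suc r)) ^ 3 / (12 * (real m - real r)\<^sup>2)) {s (Suc r)..2}"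
proof -
  define N where "N = m - r"
  define t where "t j = s (Suc (r + j))" for j
  define d where "d = (t N - t 0) / (2 * real N)"
  have N: "0 < N" "real N = real m - real r" using r by (auto simp: N_def)
  have t0: "t 0 = s (Suc r)" and tN: "t N = 2" using r by (auto simp: t_def N_def cell_bound_def)
  have mid: "c (r + j) = (t (j - 1) + t j) / 2" if "j \<in> {1..N}" for j
  proof -
    have j: "Suc (r + (j - 1)) = r + j" "r + j \<le> m" using that by (auto simp: N_def)
    have "1 \<le> s (r + j)" using cell_bound_mono[of "Suc r" "r + j"] right that j by auto
    then have "cond_mean (mixed_uniform p) (s (r + j)) (s (Suc (r + j))) = (s (r + j) + s (Suc (r + j))) / 2"
      using cell_bound_less[OF mono range m_pos j(2)] by (intro cond_mean_mixed_uniform_right p) auto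
    then show ?thesis using point_is_cond_mean[OF j(2)] unfolding t_def j(1) by simp
  qed
  have bd: "t j = (c (r + j) + c (r + Suc j)) / 2" if "j \<in> {1..<N}" for j
    using that by (auto simp: t_def cell_bound_def N_def)
  have t: "t j = t 0 + 2 * real j * d" if "j \<le> N" for j
    unfolding d_def using equal_cells_if_midpoints(1)[of N "\<lambda>j. c (r + j)" t, OF N(1) mid bd that] .
  have c: "c (r + j) = t 0 + (2 * real j - 1) * d" if "j \<in> {1..N}" for j
    unfolding d_def using equal_cells_if_midpoints(2)[of N "\<lambda>j. c (r + j)" t, OF N(1) mid bd that] .
  show "c (r + j) = s (Suc r) + (2 * real j - 1) / (2 * (real m - real r)) * (2 - s (Suc r))"
    if "j \<in> {1..m - r}" for j
    using c[of j] that by (simp add: N(2)[symmetric] N_def[symmetric] d_def t0 tN)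
  have d_nonneg: "0 \<le> d"
    using cell_bound_mono[of "Suc r" "Suc m"] r by (simp add: d_def t0 tN cell_bound_def)
  have "(min_sq_dist has_integral N * (2 / 3 * d ^ 3)) {t 0..t 0 + 2 * real N * d}"
  proof (rule has_integral_equal_cells[OF d_nonneg])
    fix j x assume j: "j \<in> {1..N}" and x: "x \<in> {t 0 + 2 * (real j - 1) * d..t 0 + 2 * real j * d}"
    have "real (j - 1) = real j - 1" using j by auto
    then have "x \<in> {t (j - 1)..t j}" using x j t[of "j - 1"] t[of j] by auto
    moreover have "t (j - 1) = s (r + j)" "t j = s (Suc (r + j))" using j by (auto simp: t_def)
    ultimately have "min_sq_dist x = (x - c (r + j))\<^sup>2"
      using j by (intro min_sq_dist_on_cell) (auto simp: N_def)
    then show "min_sq_dist x = (x - (t 0 + (2 * real j - 1) * d))\<^sup>2" using c[OF j] by simp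
  qed
  moreover have "t 0 + 2 * real N * d = 2" using t[of N] tN by simp
  moreover have "N * (2 / 3 * d ^ 3) = (2 - s (Suc r)) ^ 3 / (12 * (real m - real r)\<^sup>2)"
    using N(1) unfolding d_def t0 tN N(2)[symmetric]
    by (simp add: power_divide power_mult_distrib power2_eq_square power3_eq_cube)
  ultimately show "(min_sq_dist has_integral (2 - s (Suc r)) ^ 3 / (12 * (real m - real r)\<^sup>2)) {s (Suc r)..2}"
    by (simp add: t0)
qed

lemma quantization_error_eq:
  assumes "(min_sq_dist has_integral A) {0..1}" "(min_sq_dist has_integral B) {1..2}"
  shows "quantization_error n (mixed_uniform p) = ennreal (p * A + (1 - p) * B)"
proof -
  have "distortion (mixed_uniform p) (c ` {0..m}) = ennreal (p * A + (1 - p) * B)"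
    using assms by (intro distortion_mixed_uniform p) (auto simp: min_sq_dist_def[abs_def])
  then show ?thesis using opt by (simp add: optimal_n_means_def)
qed

end

section \<open>One point in the left interval\<close>

theorem proposition2p6:
  fixes p :: real and n k m :: nat and \<alpha> :: "real set" and a b :: "nat \<Rightarrow> real"
  assumes "0 < p" and "p < 1"
    and "n \<ge> 3"
    and "optimal_n_means n (mixed_uniform p) \<alpha>"
    and "\<alpha> \<inter> {0..1} \<noteq> {}" and "\<alpha> \<inter> {1<..2} \<noteq> {}"
    and "\<alpha> \<inter> {0..1} = a ` {1..k}" and "strict_mono_on {1..k} a"
    and "\<alpha> \<inter> {1<..2} = b ` {1..m}" and "strict_mono_on {1..m} b"
    and "k + m = n"
    and "k = 1" and "m \<ge> 2"
  shows "((a 1 + b 1) / 2 \<le> 1 \<longrightarrow>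
            a 1 = cond_mean (mixed_uniform p) 0 ((a 1 + b 1) / 2) \<and>
            b 1 = cond_mean (mixed_uniform p) ((a 1 + b 1) / 2) ((b 1 + b 2) / 2) \<and>
            (\<forall>j\<in>{1..m - 1}. b (1 + j) = (b 1 + b 2) / 2
               + (2 * real j - 1) / (2 * (real m - 1)) * (2 - (b 1 + b 2) / 2)) \<and>
            quantization_error n (mixed_uniform p) = ennreal (
                p * integral {0..(a 1 + b 1) / 2} (\<lambda>x. (x - a 1)\<^sup>2)
              + p * integral {(a 1 + b 1) / 2..1} (\<lambda>x. (x - b 1)\<^sup>2)
              + (1 - p) * integral {1..(b 1 + b 2) / 2} (\<lambda>x. (x - b 1)\<^sup>2)
              + (1 - p) * (4 - (b 1 + b 2)) ^ 3 / (96 * (real m - 1)\<^sup>2)))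
       \<and> (1 \<le> (a 1 + b 1) / 2 \<longrightarrow>
            a 1 = cond_mean (mixed_uniform p) 0 ((a 1 + b 1) / 2) \<and>
            (\<forall>j\<in>{1..m}. b j = (a 1 + b 1) / 2
               + (2 * real j - 1) / (2 * real m) * (2 - (a 1 + b 1) / 2)) \<and>
            quantization_error n (mixed_uniform p) = ennreal (
                p * integral {0..1} (\<lambda>x. (x - a 1)\<^sup>2)
              + (1 - p) * integral {1..(a 1 + b 1) / 2} (\<lambda>x. (x - a 1)\<^sup>2)
              + (1 - p) * (4 - (a 1 + b 1)) ^ 3 / (96 * (real m)\<^sup>2)))"
proof -
  \<comment> \<open>The single point of \<open>[0,1]\<close> gets index \<open>0\<close>, so the indices of \<open>b\<close> stay as they are.\<close>
  define c where "c i = (if i = 0 then a 1 else b i)" for i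
  have a1: "\<alpha> \<inter> {0..1} = {a 1}" using assms(7,12) by simp
  have b_range: "1 < b i" "b i \<le> 2" if "i \<in> {1..m}" for i
    using assms(9) that by (auto simp: set_eq_iff)
  have a_range: "0 \<le> a 1" "a 1 \<le> 1" using a1 by auto
  have "inj_on b {1..m}" using assms(10) by (rule strict_mono_on_imp_inj_on)
  have c_image: "c ` {0..m} = insert (a 1) (b ` {1..m})"
    by (auto simp: c_def image_iff Bex_def)
  have "a 1 \<notin> b ` {1..m}" using b_range a_range by fastforce
  then have card_c: "card (c ` {0..m}) = n"
    unfolding c_image using \<open>inj_on b {1..m}\<close> assms(11,12) by (simp add: card_image)
  have card_\<alpha>: "1 \<le> card \<alpha>" "card \<alpha> \<le> n" using assms(4) by (auto simp: optimal_n_means_def)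
  have "finite \<alpha>" using card_\<alpha> card.infinite by fastforce
  moreover have "c ` {0..m} \<subseteq> \<alpha>" using a1 assms(9) by (auto simp: c_image)
  \<comment> \<open>An optimal set has at most \<open>n\<close> points, so no point lies outside \<open>[0,2]\<close>.\<close>
  ultimately have \<alpha>: "c ` {0..m} = \<alpha>" using card_c card_\<alpha> by (intro card_seteq) auto
  interpret optimal_configuration p n m c
  proof
    show "strict_mono_on {0..m} c"
    proof (rule strict_mono_onI)
      fix i j assume "i \<in> {0..m}" "j \<in> {0..m}" "i < j"
      then show "c i < c j"
        using b_range[of j] a_range strict_mono_onD[OF assms(10), of i j] by (auto simp: c_def)
    qed
    show "c ` {0..m} \<subseteq> {0..2}" unfolding c_image using b_range a_range by force
  qed (use assms \<alpha> in auto)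
  let ?M = "(a 1 + b 1) / 2" and ?T = "(b 1 + b 2) / 2"
  have c_vals: "c 0 = a 1" "c (Suc 0) = b 1" by (auto simp: c_def)
  have s: "s 0 = 0" "s (Suc 0) = ?M" "s (Suc (Suc 0)) = ?T"
    using assms(13) by (auto simp: cell_bound_def c_def numeral_2_eq_2)
  have b12: "1 < b 1" "b 1 \<le> 2" "1 < b 2" "b 2 \<le> 2" using b_range[of 1] b_range[of 2] assms(13) by auto
  have a1_mean: "a 1 = cond_mean (mixed_uniform p) 0 ?M"
    by (rule point_is_cond_mean[of 0, unfolded s c_vals, OF le0])
  have cube: "(2 - x / 2) ^ 3 / (12 * y) = (4 - x) ^ 3 / (96 * y)" for x y :: real
  proof -
    have half: "2 - x / 2 = (4 - x) / 2" by simp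
    show ?thesis unfolding half by (simp add: power_divide)
  qed
  show ?thesis
  proof (intro conjI impI ballI)
    assume M: "?M \<le> 1"
    show "a 1 = cond_mean (mixed_uniform p) 0 ?M" by (rule a1_mean)
    show "b 1 = cond_mean (mixed_uniform p) ?M ?T"
      by (rule point_is_cond_mean[of "Suc 0", unfolded s c_vals]) (use assms(13) in simp)
    have r: "Suc 0 < m" "1 \<le> s (Suc (Suc 0))" using assms(13) s b12 by auto
    show "b (1 + j) = ?T + (2 * real j - 1) / (2 * (real m - 1)) * (2 - ?T)"
      if "j \<in> {1..m - 1}" for j
      using equally_spaced[OF r, of j] that s by (simp add: c_def)
    have left: "(min_sq_dist has_integral
        integral {0..?M} (\<lambda>x. (x - c 0)\<^sup>2) + integral {?M..1} (\<lambda>x. (x - c (Suc 0))\<^sup>2)) {0..1}"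
      using M a_range b12 s r
      by (intro has_integral_combine[where c = ?M] min_sq_dist_has_integral_within_cell) auto
    have tail: "(min_sq_dist has_integral (2 - ?T) ^ 3 / (12 * (real m - 1)\<^sup>2)) {?T..2}"
      using min_sq_dist_has_integral_tail[OF r] unfolding s by simp
    have right: "(min_sq_dist has_integral integral {1..?T} (\<lambda>x. (x - c (Suc 0))\<^sup>2)
        + (2 - ?T) ^ 3 / (12 * (real m - 1)\<^sup>2)) {1..2}"
      using M a_range b12 s r
      by (intro has_integral_combine[where c = ?T] min_sq_dist_has_integral_within_cell tail) auto
    from quantization_error_eq[OF left right]
    show "quantization_error n (mixed_uniform p) = ennreal (
                p * integral {0..(a 1 + b 1) / 2} (\<lambda>x. (x - a 1)\<^sup>2)
              + p * integral {(a 1 + b 1) / 2..1} (\<lambda>x. (x - b 1)\<^sup>2)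
              + (1 - p) * integral {1..(b 1 + b 2) / 2} (\<lambda>x. (x - b 1)\<^sup>2)
              + (1 - p) * (4 - (b 1 + b 2)) ^ 3 / (96 * (real m - 1)\<^sup>2))"
      by (simp only: cube c_vals distrib_left add.assoc times_divide_eq_right)
  next
    assume M: "1 \<le> ?M"
    show "a 1 = cond_mean (mixed_uniform p) 0 ?M" by (rule a1_mean)
    have r: "0 < m" "1 \<le> s (Suc 0)" using assms(13) s M by auto
    show "b j = ?M + (2 * real j - 1) / (2 * real m) * (2 - ?M)" if "j \<in> {1..m}" for j
      using equally_spaced[OF r, of j] that s by (simp add: c_def)
    have left: "(min_sq_dist has_integral integral {0..1} (\<lambda>x. (x - c 0)\<^sup>2)) {0..1}"
      using M s r by (intro min_sq_dist_has_integral_within_cell) auto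
    have tail: "(min_sq_dist has_integral (2 - ?M) ^ 3 / (12 * (real m)\<^sup>2)) {?M..2}"
      using min_sq_dist_has_integral_tail[OF r] unfolding s by simp
    have right: "(min_sq_dist has_integral integral {1..?M} (\<lambda>x. (x - c 0)\<^sup>2)
        + (2 - ?M) ^ 3 / (12 * (real m)\<^sup>2)) {1..2}"
      using M a_range b12 s r
      by (intro has_integral_combine[where c = ?M] min_sq_dist_has_integral_within_cell tail) auto
    from quantization_error_eq[OF left right]
    show "quantization_error n (mixed_uniform p) = ennreal (
                p * integral {0..1} (\<lambda>x. (x - a 1)\<^sup>2)
              + (1 - p) * integral {1..(a 1 + b 1) / 2} (\<lambda>x. (x - a 1)\<^sup>2)
              + (1 - p) * (4 - (a 1 + b 1)) ^ 3 / (96 * (real m)\<^sup>2))"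
      by (simp only: cube c_vals distrib_left add.assoc times_divide_eq_right)
  qed
qed

end
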